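(* Let $\mathbb{X}$ be a reflexive, Kadets-Klee real Banach space and let $\mathbb{Y}$ be a real Banach space. Let $T\in\mathbb{K}(\mathbb{X},\mathbb{Y})$ be a smooth operator. Then there exists $x_0\in S_{\mathbb{X}}$ such that for each $\epsilon>0$ there exists $\delta(\epsilon)>0$ such that for any $0<\delta\leq\delta(\epsilon)$, $$M_T(\delta)\subseteq B(x_0,\epsilon)\cup B(-x_0,\epsilon).$$
   Context: $\mathbb{K}(\mathbb{X},\mathbb{Y})$ is the space of compact linear operators with the operator norm; $S_Z$ is the unit sphere of a normed space $Z$; $B(x,r)$ is the open ball with center $x$ and radius $r$. $\mathbb{X}$ is Kadets-Klee if $x_n\to x$ weakly and $\|x_n\|\to\|x\|$ imply $x_n\to x$ in norm. A non-zero element $z$ of a normed space $Z$ is smooth if there is exactly one $f\in S_{Z^*}$ with $f(z)=\|z\|$; a smooth operator in $\mathbb{K}(\mathbb{X},\mathbb{Y})$ is a smooth (in particular non-zero) element of the normed space $\mathbb{K}(\mathbb{X},\mathbb{Y})$. For an operator $T$ and $\delta>0$, $M_T(\delta)=\{x\in S_{\mathbb{X}}:\|Tx\|>\|T\|-\delta\}$. *)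

theory Defs
  imports "HOL-Analysis.Analysis"
begin

lift_definition bidual_embedding ::
    "'a::real_normed_vector \<Rightarrow> (('a \<Rightarrow>\<^sub>L real) \<Rightarrow>\<^sub>L real)"
  is "\<lambda>x f. blinfun_apply f x"
  by (rule bounded_linear_intros) (rule bounded_linear_ident)

text \<open>
  Properties of a space are predicates on its type; the argument is written \<open>TYPE('a)\<close>.
\<close>

definition reflexive_space :: "'a::real_normed_vector itself \<Rightarrow> bool" where
  "reflexive_space _ \<longleftrightarrow> surj (bidual_embedding :: 'a \<Rightarrow> _)"

definition weakly_tendsto :: "(nat \<Rightarrow> 'a::real_normed_vector) \<Rightarrow> 'a \<Rightarrow> bool" where
  "weakly_tendsto u x \<longleftrightarrow> (\<forall>f :: 'a \<Rightarrow>\<^sub>L real. (\<lambda>n. f (u n)) \<longlonglongrightarrow> f x)"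

definition kadets_klee :: "'a::real_normed_vector itself \<Rightarrow> bool" where
  "kadets_klee _ \<longleftrightarrow>
    (\<forall>(u :: nat \<Rightarrow> 'a) x. weakly_tendsto u x \<and> (\<lambda>n. norm (u n)) \<longlonglongrightarrow> norm x \<longrightarrow> u \<longlonglongrightarrow> x)"

definition smooth_element :: "'z::real_normed_vector \<Rightarrow> bool" where
  "smooth_element z \<longleftrightarrow> z \<noteq> 0 \<and> (\<exists>!f :: 'z \<Rightarrow>\<^sub>L real. norm f = 1 \<and> blinfun_apply f z = norm z)"

definition compact_operator ::
    "('a::real_normed_vector \<Rightarrow>\<^sub>L 'b::real_normed_vector) \<Rightarrow> bool" where
  "compact_operator T \<longleftrightarrow> (\<forall>B. bounded B \<longrightarrow> compact (closure (blinfun_apply T ` B)))"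

lemma compact_operator_zero: "compact_operator 0"
  unfolding compact_operator_def
proof (intro allI impI)
  fix B :: "'a set"
  have "blinfun_apply 0 ` B \<subseteq> {0 :: 'b}" by auto
  hence "finite (blinfun_apply (0 :: 'a \<Rightarrow>\<^sub>L 'b) ` B)"
    by (rule finite_subset) simp
  thus "compact (closure (blinfun_apply (0 :: 'a \<Rightarrow>\<^sub>L 'b) ` B))"
    by (simp add: finite_imp_closed finite_imp_compact)
qed

lemma compact_operator_add:
  assumes "compact_operator S" "compact_operator T"
  shows "compact_operator (S + T)"
  unfolding compact_operator_def
proof (intro allI impI)
  fix B :: "'a set"
  assume B: "bounded B"
  let ?K = "{x + y |x y. x \<in> closure (blinfun_apply S ` B) \<and> y \<in> closure (blinfun_apply T ` B)}"
  have K: "compact ?K"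
    using assms B by (intro compact_sums) (auto simp: compact_operator_def)
  have "blinfun_apply (S + T) ` B \<subseteq> ?K"
  proof
    fix z assume "z \<in> blinfun_apply (S + T) ` B"
    then obtain x where "x \<in> B" "z = S x + T x" by (auto simp: blinfun.add_left)
    thus "z \<in> ?K" using closure_subset by blast
  qed
  hence "closure (blinfun_apply (S + T) ` B) \<subseteq> ?K"
    using K by (intro closure_minimal compact_imp_closed)
  thus "compact (closure (blinfun_apply (S + T) ` B))"
    using compact_Int_closed[OF K closed_closure[of "blinfun_apply (S + T) ` B"]]
    by (simp only: inf.absorb2)
qed

lemma compact_operator_scaleR:
  assumes "compact_operator T"
  shows "compact_operator (c *\<^sub>R T)"
  unfolding compact_operator_def
proof (intro allI impI)
  fix B :: "'a set"
  assume B: "bounded B"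
  have "blinfun_apply (c *\<^sub>R T) ` B = (*\<^sub>R) c ` (blinfun_apply T ` B)"
    by (auto simp: blinfun.scaleR_left image_image)
  thus "compact (closure (blinfun_apply (c *\<^sub>R T) ` B))"
    using assms B by (simp add: closure_scaleR[symmetric] compact_scaling compact_operator_def)
qed

text \<open>
  A type of its own, so that the dual of the space of compact operators is the library's dual and
  smoothness of a compact operator does not refer to functionals on all bounded operators.
\<close>

typedef (overloaded) ('a, 'b) compact_op =
    "{T :: 'a::real_normed_vector \<Rightarrow>\<^sub>L 'b::real_normed_vector. compact_operator T}"
  morphisms blinfun_of_compact_op Compact_op
  using compact_operator_zero by auto

setup_lifting type_definition_compact_op

instantiation compact_op :: (real_normed_vector, real_normed_vector) real_normed_vector
begin

lift_definition zero_compact_op :: "('a, 'b) compact_op" is 0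
  by (rule compact_operator_zero)

lift_definition plus_compact_op ::
    "('a, 'b) compact_op \<Rightarrow> ('a, 'b) compact_op \<Rightarrow> ('a, 'b) compact_op" is "(+)"
  by (rule compact_operator_add)

lift_definition scaleR_compact_op ::
    "real \<Rightarrow> ('a, 'b) compact_op \<Rightarrow> ('a, 'b) compact_op" is "(*\<^sub>R)"
  by (rule compact_operator_scaleR)

lift_definition uminus_compact_op ::
    "('a, 'b) compact_op \<Rightarrow> ('a, 'b) compact_op" is uminus
  using compact_operator_scaleR[where c = "-1"] by simp

lift_definition minus_compact_op ::
    "('a, 'b) compact_op \<Rightarrow> ('a, 'b) compact_op \<Rightarrow> ('a, 'b) compact_op" is "(-)"
  using compact_operator_add compact_operator_scaleR[where c = "-1"]
  by (metis diff_conv_add_uminus scaleR_minus1_left)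

lift_definition norm_compact_op :: "('a, 'b) compact_op \<Rightarrow> real" is norm .

definition dist_compact_op :: "('a, 'b) compact_op \<Rightarrow> ('a, 'b) compact_op \<Rightarrow> real" where
  "dist_compact_op S T = norm (S - T)"

definition sgn_compact_op :: "('a, 'b) compact_op \<Rightarrow> ('a, 'b) compact_op" where
  "sgn_compact_op T = inverse (norm T) *\<^sub>R T"

definition uniformity_compact_op :: "(('a, 'b) compact_op \<times> ('a, 'b) compact_op) filter" where
  "uniformity_compact_op = (INF e\<in>{0<..}. principal {(S, T). dist S T < e})"

definition open_compact_op :: "('a, 'b) compact_op set \<Rightarrow> bool" where
  "open_compact_op U = (\<forall>S\<in>U. \<forall>\<^sub>F (S', T) in uniformity. S' = S \<longrightarrow> T \<in> U)"

instance
proof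
  fix S T U :: "('a, 'b) compact_op" and V :: "('a, 'b) compact_op set" and a b :: real
  show "S + T + U = S + (T + U)" by transfer simp
  show "S + T = T + S" by transfer simp
  show "0 + S = S" by transfer simp
  show "- S + S = 0" by transfer simp
  show "S - T = S + - T" by transfer simp
  show "a *\<^sub>R (S + T) = a *\<^sub>R S + a *\<^sub>R T" by transfer (simp add: scaleR_right_distrib)
  show "(a + b) *\<^sub>R S = a *\<^sub>R S + b *\<^sub>R S" by transfer (simp add: scaleR_left_distrib)
  show "a *\<^sub>R b *\<^sub>R S = (a * b) *\<^sub>R S" by transfer simp
  show "1 *\<^sub>R S = S" by transfer simp
  show "dist S T = norm (S - T)" by (rule dist_compact_op_def)
  show "sgn S = inverse (norm S) *\<^sub>R S" by (rule sgn_compact_op_def)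
  show "uniformity = (INF e\<in>{0<..}. principal {(S :: ('a, 'b) compact_op, T). dist S T < e})"
    by (rule uniformity_compact_op_def)
  show "open V = (\<forall>S\<in>V. \<forall>\<^sub>F (S', T) in uniformity. S' = S \<longrightarrow> T \<in> V)"
    by (rule open_compact_op_def)
  show "(norm S = 0) = (S = 0)" by transfer simp
  show "norm (S + T) \<le> norm S + norm T" by transfer (rule norm_triangle_ineq)
  show "norm (a *\<^sub>R S) = \<bar>a\<bar> * norm S" by transfer simp
qed

end

text \<open>The set \<open>M\<^sub>T(\<delta>)\<close>.\<close>

definition near_max_set ::
    "('a::real_normed_vector \<Rightarrow>\<^sub>L 'b::real_normed_vector) \<Rightarrow> real \<Rightarrow> 'a set" where
  "near_max_set T \<delta> = {x \<in> sphere 0 1. norm (blinfun_apply T x) > norm T - \<delta>}"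

end

theory Submission
  imports Defs
begin

text \<open>
  If \<open>x\<^sub>n\<close> is a maximizing sequence for \<open>T\<close>, compactness gives a subsequence with
  \<open>T x\<^sub>n \<longlonglongrightarrow> y\<close>, and a norming functional \<open>\<psi>\<close> of \<open>y\<close> turns it into functionals
  \<open>S \<mapsto> \<psi> (S x\<^sub>n)\<close> of norm at most 1 that asymptotically attain the norm at \<open>T\<close>. By
  Hahn-Banach, smoothness of \<open>T\<close> makes the norm Gateaux differentiable at \<open>T\<close>, which forces these
  functionals to converge pointwise to the support functional \<open>F\<close> of \<open>T\<close>. On rank-one operators \<open>g \<otimes> z\<close> this says
  that \<open>\<psi> z * g x\<^sub>n\<close> converges, so by reflexivity \<open>x\<^sub>n\<close> converges weakly to some \<open>l\<close>, and
  \<open>\<psi> (T l) = norm T\<close> forces \<open>norm l = 1\<close>; the Kadets-Klee property makes the convergence strong.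
  The identity \<open>F (g \<otimes> z) = \<psi> z * g l\<close> determines \<open>l\<close> up to sign.
\<close>

section \<open>Sublinear functionals and their tangents\<close>

definition sublinear :: "('a::real_vector \<Rightarrow> real) \<Rightarrow> bool" where
  "sublinear p \<longleftrightarrow> (\<forall>x y. p (x + y) \<le> p x + p y) \<and> (\<forall>c x. 0 \<le> c \<longrightarrow> p (c *\<^sub>R x) = c * p x)"

text \<open>The scaling inequality suffices: applied to \<open>inverse c\<close> and
  \<open>c *\<^sub>R x\<close> it yields its own converse.\<close>

lemma sublinearI:
  assumes zero: "p 0 = 0"
    and add: "\<And>x y. p (x + y) \<le> p x + p y"
    and scale: "\<And>c x. 0 < c \<Longrightarrow> p (c *\<^sub>R x) \<le> c * p x"
  shows "sublinear p"
proof -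
  have "p (c *\<^sub>R x) = c * p x" if "0 \<le> c" for c x
  proof (cases "c = 0")
    case False
    then have "c > 0" using that by simp
    have "p x \<le> inverse c * p (c *\<^sub>R x)"
      using scale[of "inverse c" "c *\<^sub>R x"] \<open>c > 0\<close> by simp
    then have "c * p x \<le> p (c *\<^sub>R x)"
      using \<open>c > 0\<close> by (simp add: field_simps)
    then show ?thesis using scale[OF \<open>c > 0\<close>, of x] by simp
  qed (simp add: zero)
  then show ?thesis by (simp add: sublinear_def add)
qed

lemma sublinear_add: "sublinear p \<Longrightarrow> p (x + y) \<le> p x + p y"
  by (simp add: sublinear_def)

lemma sublinear_scaleR: "sublinear p \<Longrightarrow> 0 \<le> c \<Longrightarrow> p (c *\<^sub>R x) = c * p x"
  by (simp add: sublinear_def)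

lemma sublinear_zero: "sublinear p \<Longrightarrow> p 0 = 0"
  using sublinear_scaleR[of p 0 0] by simp

lemma sublinear_minus: "sublinear p \<Longrightarrow> - p (- x) \<le> p x"
  using sublinear_add[of p x "- x"] sublinear_zero[of p] by simp

lemma sublinear_norm: "sublinear norm"
  by (simp add: sublinear_def norm_triangle_ineq)

text \<open>
  With \<open>s = 1 / h\<close> the infimum runs over \<open>(p (x + h *\<^sub>R y) - p x) / h\<close>, so this is the one-sided
  directional derivative of \<open>p\<close> at \<open>x\<close>.
\<close>

definition tangent :: "('a::real_vector \<Rightarrow> real) \<Rightarrow> 'a \<Rightarrow> 'a \<Rightarrow> real" where
  "tangent p x y = (INF s\<in>{0..}. p (y + s *\<^sub>R x) - s * p x)"

text \<open>Bounds the family in \<open>tangent\<close> from below, so that its real infimum is a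
  genuine one.\<close>

lemma tangent_lower:
  assumes "sublinear p" "0 \<le> s"
  shows "- p (- y) \<le> p (y + s *\<^sub>R x) - s * p x"
  using sublinear_add[OF assms(1), of "y + s *\<^sub>R x" "- y"] sublinear_scaleR[OF assms, of x] by simp

lemma tangent_le:
  assumes "sublinear p" "0 \<le> s"
  shows "tangent p x y \<le> p (y + s *\<^sub>R x) - s * p x"
  unfolding tangent_def using assms
  by (intro cINF_lower bdd_belowI2[where m = "- p (- y)"] tangent_lower) auto

lemma tangent_greatest:
  assumes "\<And>s. 0 \<le> s \<Longrightarrow> a \<le> p (y + s *\<^sub>R x) - s * p x"
  shows "a \<le> tangent p x y"
  unfolding tangent_def using assms by (intro cINF_greatest) auto

text \<open>Parameters \<open>s\<close> for \<open>y\<close> and \<open>t\<close> for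
  \<open>z\<close> combine to \<open>s + t\<close> for \<open>y + z\<close>; scaling by
  \<open>c\<close> reparametrizes \<open>s\<close> as \<open>c * s\<close>.\<close>

lemma sublinear_tangent:
  assumes "sublinear p"
  shows "sublinear (tangent p x)"
proof (rule sublinearI)
  show "tangent p x 0 = 0"
    using tangent_le[OF assms, of 0 x 0] sublinear_zero[OF assms] sublinear_scaleR[OF assms]
    by (intro antisym tangent_greatest) auto
next
  fix y z
  have st: "tangent p x (y + z) \<le> (p (y + s *\<^sub>R x) - s * p x) + (p (z + t *\<^sub>R x) - t * p x)"
    if "0 \<le> s" "0 \<le> t" for s t
    using tangent_le[OF assms, of "s + t" x "y + z"]
      sublinear_add[OF assms, of "y + s *\<^sub>R x" "z + t *\<^sub>R x"] that
    by (simp add: algebra_simps)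
  \<comment> \<open>The infimum is taken over \<open>s\<close> with \<open>t\<close> fixed, and
    afterwards over \<open>t\<close>.\<close>
  have "tangent p x (y + z) - tangent p x y \<le> p (z + t *\<^sub>R x) - t * p x" if "0 \<le> t" for t
    using tangent_greatest[of "tangent p x (y + z) - (p (z + t *\<^sub>R x) - t * p x)" p y x] st[OF _ that]
    by (simp add: algebra_simps)
  then show "tangent p x (y + z) \<le> tangent p x y + tangent p x z"
    using tangent_greatest[of "tangent p x (y + z) - tangent p x y" p z x] by simp
next
  fix c :: real and y
  assume c: "0 < c"
  have "tangent p x (c *\<^sub>R y) / c \<le> p (y + s *\<^sub>R x) - s * p x" if "0 \<le> s" for s
    using tangent_le[OF assms, of "c * s" x "c *\<^sub>R y"] that c
      sublinear_scaleR[OF assms, of c "y + s *\<^sub>R x"]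
    by (simp add: field_simps scaleR_add_right)
  then have "tangent p x (c *\<^sub>R y) / c \<le> tangent p x y"
    by (rule tangent_greatest)
  then show "tangent p x (c *\<^sub>R y) \<le> c * tangent p x y"
    using c by (simp add: field_simps)
qed

lemma tangent_le_self: "sublinear p \<Longrightarrow> tangent p x y \<le> p y"
  using tangent_le[of p 0 x y] by simp

lemma tangent_minus: "sublinear p \<Longrightarrow> tangent p x (- x) \<le> - p x"
  using tangent_le[of p 1 x "- x"] sublinear_zero[of p] by simp

text \<open>At \<open>- x\<close> the tangent is at most \<open>- p x\<close>, which by linearity
  gives the inequality missing from \<open>f \<le> p\<close>.\<close>

lemma linear_le_tangent_eq:
  assumes "sublinear p" "linear f" "\<And>y. f y \<le> tangent p x y"
  shows "f x = p x"
proof (rule antisym)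
  show "f x \<le> p x"
    using assms(3) tangent_le_self[OF assms(1)] by (rule order_trans)
  show "p x \<le> f x"
    using order_trans[OF assms(3) tangent_minus[OF assms(1), of x]] linear_neg[OF assms(2), of x] by simp
qed

section \<open>Hahn-Banach through minimal sublinear functionals\<close>

text \<open>The pointwise infimum of the chain works; it is finite because every member is at least
  \<open>- p (- x)\<close> at \<open>x\<close>.\<close>

lemma sublinear_chain_lower_bound:
  assumes C: "\<And>q. q \<in> C \<Longrightarrow> sublinear q" and "C \<noteq> {}"
    and p: "\<And>q. q \<in> C \<Longrightarrow> q \<le> p"
    and total: "\<And>q r. q \<in> C \<Longrightarrow> r \<in> C \<Longrightarrow> q \<le> r \<or> r \<le> q"
  shows "\<exists>u. sublinear u \<and> (\<forall>q\<in>C. u \<le> q)"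
proof -
  define u where "u x = (INF q\<in>C. q x)" for x
  have lower: "u x \<le> q x" if "q \<in> C" for q x
    unfolding u_def
  proof (rule cINF_lower[OF bdd_belowI2 that])
    fix r assume "r \<in> C"
    then show "- p (- x) \<le> r x"
      using sublinear_minus[OF C, of r x] le_funD[OF p, of r "- x"] by simp
  qed
  have greatest: "a \<le> u x" if "\<And>q. q \<in> C \<Longrightarrow> a \<le> q x" for a x
    unfolding u_def using that by (intro cINF_greatest \<open>C \<noteq> {}\<close>)
  have "sublinear u"
  proof (rule sublinearI)
    obtain q where "q \<in> C" using \<open>C \<noteq> {}\<close> by auto
    then show "u 0 = 0"
      using lower[of q 0] C by (intro antisym greatest) (auto simp: sublinear_zero)
  next
    fix x y
    \<comment> \<open>Subadditivity of the smaller of the two functionals bounds the mixed sum; this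
      is where the chain is totally ordered.\<close>
    have qr: "u (x + y) \<le> q x + r y" if q: "q \<in> C" and r: "r \<in> C" for q r
    proof (cases "q \<le> r")
      case True
      then show ?thesis
        using lower[OF q, of "x + y"] sublinear_add[OF C[OF q], of x y] le_funD[OF True, of y] by simp
    next
      case False
      then have "r \<le> q" using total[OF q r] by simp
      then show ?thesis
        using lower[OF r, of "x + y"] sublinear_add[OF C[OF r], of x y] le_funD[of r q x] by simp
    qed
    have "u (x + y) - u x \<le> r y" if "r \<in> C" for r
      using greatest[of "u (x + y) - r y" x] qr[OF _ that] by (simp add: algebra_simps)
    then show "u (x + y) \<le> u x + u y"
      using greatest[of "u (x + y) - u x" y] by simp
  next
    fix c :: real and x
    assume "0 < c"
    have "u (c *\<^sub>R x) / c \<le> q x" if "q \<in> C" for q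
      using lower[OF that, of "c *\<^sub>R x"] sublinear_scaleR[OF C[OF that], of c x] \<open>0 < c\<close>
      by (simp add: field_simps)
    then have "u (c *\<^sub>R x) / c \<le> u x" by (rule greatest)
    then show "u (c *\<^sub>R x) \<le> c * u x"
      using \<open>0 < c\<close> by (simp add: field_simps)
  qed
  then show ?thesis using lower by (auto simp: le_fun_def)
qed

text \<open>A minimal sublinear functional \<open>m\<close> is linear, since it equals all its tangents.\<close>

lemma sublinear_dominates_linear:
  fixes p :: "'a::real_vector \<Rightarrow> real"
  assumes "sublinear p"
  obtains f where "linear f" "\<And>y. f y \<le> p y"
proof -
  define A where "A = {q. sublinear q \<and> q \<le> p}"
  \<comment> \<open>Zorn's lemma is used for the reversed order, so its maximal element is a minimal
    functional.\<close>
  have "partial_order_on A (relation_of (\<ge>) A)"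
    by (rule partial_order_on_relation_ofI) auto
  moreover have "\<exists>u\<in>A. \<forall>q\<in>C. q \<ge> u" if "C \<in> Chains (relation_of (\<ge>) A)" for C
  proof (cases "C = {}")
    case True
    then show ?thesis using assms by (auto simp: A_def)
  next
    case False
    have C: "q \<in> A" "q \<le> r \<or> r \<le> q" if "q \<in> C" "r \<in> C" for q r
      using \<open>C \<in> _\<close> that by (auto simp: Chains_def relation_of_def)
    obtain u where "sublinear u" "\<forall>q\<in>C. u \<le> q"
      using sublinear_chain_lower_bound[of C p] C False by (auto simp: A_def)
    moreover obtain q where "q \<in> C" using False by auto
    moreover have "q \<le> p" using C(1)[of q q] \<open>q \<in> C\<close> by (simp add: A_def)
    ultimately show ?thesis by (auto simp: A_def intro: order_trans)
  qed
  ultimately obtain m where m: "m \<in> A" "\<And>q. q \<in> A \<Longrightarrow> m \<ge> q \<Longrightarrow> q = m"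
    using predicate_Zorn[of A "(\<ge>)"] by blast
  then have sub: "sublinear m" and "m \<le> p" by (auto simp: A_def)
  have "tangent m x = m" for x
  proof (rule m(2))
    show "m \<ge> tangent m x" by (simp add: le_fun_def tangent_le_self[OF sub])
    then show "tangent m x \<in> A"
      using \<open>m \<le> p\<close> sublinear_tangent[OF sub] by (auto simp: A_def)
  qed
  \<comment> \<open>Since \<open>m\<close> is its own tangent at \<open>x\<close>,
    \<open>tangent_minus\<close> reverses the general inequality
    \<open>sublinear_minus\<close>.\<close>
  then have "m (- x) = - m x" for x
    using tangent_minus[OF sub, of x] sublinear_minus[OF sub, of "- x"] by simp
  note minus = this
  have "linear m"
  proof (rule linearI)
    fix x y show "m (x + y) = m x + m y"
      using sublinear_add[OF sub, of x y] sublinear_add[OF sub, of "- x" "- y"] minus[of "x + y"]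
      by (simp add: minus)
  next
    fix c x show "m (c *\<^sub>R x) = c *\<^sub>R m x"
    proof (cases "0 \<le> c")
      case False
      then show ?thesis
        using sublinear_scaleR[OF sub, of "- c" x] minus[of "c *\<^sub>R x"] by simp
    qed (simp add: sublinear_scaleR[OF sub])
  qed
  then show thesis using that \<open>m \<le> p\<close> by (simp add: le_fun_def)
qed

lemma linear_le_norm_blinfun:
  fixes f :: "'a::real_normed_vector \<Rightarrow> real"
  assumes "linear f" "\<And>x. f x \<le> norm x"
  obtains F :: "'a \<Rightarrow>\<^sub>L real" where "blinfun_apply F = f" "norm F \<le> 1"
proof -
  have bound: "norm (f x) \<le> 1 * norm x" for x
    using assms(2)[of x] assms(2)[of "- x"] linear_neg[OF assms(1), of x] by simp
  then have "bounded_linear f"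
    using assms(1) by (intro bounded_linear_intro[where K = 1])
      (auto simp: linear_add linear_scale)
  then have "blinfun_apply (Blinfun f) = f" by (rule bounded_linear_Blinfun_apply)
  then show thesis
    using that norm_blinfun_bound[of 1 "Blinfun f"] bound by simp
qed

text \<open>A linear functional below the tangent of the norm at \<open>x\<close> must touch the
  norm there. The bound \<open>norm F \<le> 1\<close> also covers \<open>x = 0\<close>.\<close>

lemma norming_functional:
  fixes x :: "'a::real_normed_vector"
  obtains F :: "'a \<Rightarrow>\<^sub>L real" where "norm F \<le> 1" "F x = norm x"
proof -
  obtain f where f: "linear f" "\<And>y. f y \<le> tangent norm x y"
    using sublinear_dominates_linear[OF sublinear_tangent[OF sublinear_norm, of x]] by blast
  then have "\<And>y. f y \<le> norm y"
    using tangent_le_self[OF sublinear_norm] by (blast intro: order_trans)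
  then obtain F :: "'a \<Rightarrow>\<^sub>L real" where "blinfun_apply F = f" "norm F \<le> 1"
    using linear_le_norm_blinfun[OF f(1)] by blast
  then show thesis
    using that linear_le_tangent_eq[OF sublinear_norm f] by simp
qed

section \<open>Smoothness as Gateaux differentiability\<close>

text \<open>For each \<open>y\<close> some support functional at \<open>x\<close> attains the
  tangent value at \<open>y\<close>. Uniqueness makes all of these the same functional, so the
  tangent is linear.\<close>

lemma smooth_element_tangent:
  fixes x :: "'a::real_normed_vector"
  assumes "smooth_element x"
  obtains F :: "'a \<Rightarrow>\<^sub>L real" where "blinfun_apply F = tangent norm x"
proof -
  have "x \<noteq> 0" using assms by (simp add: smooth_element_def)
  have sub: "sublinear (tangent norm x)" by (rule sublinear_tangent[OF sublinear_norm])
  have "\<exists>F :: 'a \<Rightarrow>\<^sub>L real. norm F = 1 \<and> blinfun_apply F x = norm x \<and>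
      blinfun_apply F y = tangent norm x y" for y
  proof -
    \<comment> \<open>The inner tangent forces \<open>f x = norm x\<close>, the outer one forces
      \<open>f y = tangent norm x y\<close>.\<close>
    obtain f where f: "linear f" "\<And>z. f z \<le> tangent (tangent norm x) y z"
      using sublinear_dominates_linear[OF sublinear_tangent[OF sub, of y]] by blast
    have fy: "f y = tangent norm x y" by (rule linear_le_tangent_eq[OF sub f])
    have f': "\<And>z. f z \<le> tangent norm x z"
      using f(2) tangent_le_self[OF sub] by (blast intro: order_trans)
    then have fx: "f x = norm x" by (rule linear_le_tangent_eq[OF sublinear_norm f(1)])
    have "\<And>z. f z \<le> norm z"
      using f' tangent_le_self[OF sublinear_norm] by (blast intro: order_trans)
    then obtain F :: "'a \<Rightarrow>\<^sub>L real" where F: "blinfun_apply F = f" "norm F \<le> 1"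
      using linear_le_norm_blinfun[OF f(1)] by blast
    then have "norm F \<ge> 1"
      using norm_blinfun[of F x] fx \<open>x \<noteq> 0\<close> by simp
    then show ?thesis using F fx fy by (intro exI[of _ F]) simp
  qed
  note ex = this
  obtain F :: "'a \<Rightarrow>\<^sub>L real" where F: "\<And>G :: 'a \<Rightarrow>\<^sub>L real. norm G = 1 \<and> blinfun_apply G x = norm x \<Longrightarrow> G = F"
    using assms by (auto simp: smooth_element_def)
  have "F y = tangent norm x y" for y
    using ex[of y] F by blast
  then show thesis using that[of F] by auto
qed

text \<open>Each difference quotient bounds \<phi> asymptotically from above; linearity of
  \<open>F\<close> turns the upper bound at \<open>- y\<close> into the lower bound at
  \<open>y\<close>.\<close>

lemma tendsto_tangent_norm:
  fixes F :: "'a::real_normed_vector \<Rightarrow>\<^sub>L real" and \<phi> :: "nat \<Rightarrow> 'a \<Rightarrow> real"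
  assumes F: "blinfun_apply F = tangent norm x"
    and lin: "\<And>n. linear (\<phi> n)" and le: "\<And>n y. \<phi> n y \<le> norm y"
    and lim: "(\<lambda>n. \<phi> n x) \<longlonglongrightarrow> norm x"
  shows "(\<lambda>n. \<phi> n y) \<longlonglongrightarrow> F y"
proof -
  have upper: "\<forall>\<^sub>F n in sequentially. \<phi> n z < a" if "F z < a" for z a
  proof -
    have "\<exists>s\<ge>0. norm (z + s *\<^sub>R x) - s * norm x < a"
      using that tangent_greatest[of a norm z x] F by (metis not_le)
    then obtain s where s: "0 \<le> s" "norm (z + s *\<^sub>R x) - s * norm x < a" by blast
    have "(\<lambda>n. norm (z + s *\<^sub>R x) - s * \<phi> n x) \<longlonglongrightarrow> norm (z + s *\<^sub>R x) - s * norm x"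
      by (intro tendsto_intros lim)
    then have "\<forall>\<^sub>F n in sequentially. norm (z + s *\<^sub>R x) - s * \<phi> n x < a"
      using s(2) by (rule order_tendstoD)
    then show ?thesis
    proof eventually_elim
      case (elim n)
      then show ?case
        using le[of n "z + s *\<^sub>R x"] by (simp add: linear_add[OF lin] linear_scale[OF lin])
    qed
  qed
  show ?thesis
  proof (rule order_tendstoI)
    fix a assume "a < F y"
    then have "\<forall>\<^sub>F n in sequentially. \<phi> n (- y) < - a"
      by (intro upper) (simp add: blinfun.minus_right)
    then show "\<forall>\<^sub>F n in sequentially. a < \<phi> n y"
      by (simp add: linear_neg[OF lin])
  qed (rule upper)
qed

section \<open>Evaluation and rank-one operators\<close>

lemma norm_compact_op_apply:
  "norm (blinfun_of_compact_op S x) \<le> norm S * norm x"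
  by transfer (rule norm_blinfun)

lemma linear_compact_op_apply: "linear (\<lambda>S. blinfun_of_compact_op S x)"
  by (rule linearI; transfer; simp add: blinfun.bilinear_simps)

lift_definition rank_one ::
    "('a::real_normed_vector \<Rightarrow>\<^sub>L real) \<Rightarrow> 'b::real_normed_vector \<Rightarrow> ('a, 'b) compact_op"
  is "\<lambda>g z. blinfun_scaleR_left z o\<^sub>L g"
  unfolding compact_operator_def
proof (intro allI impI)
  fix g :: "'a \<Rightarrow>\<^sub>L real" and z :: 'b and B :: "'a set"
  assume "bounded B"
  let ?f = "\<lambda>c. c *\<^sub>R z" and ?T = "blinfun_scaleR_left z o\<^sub>L g"
  have "bounded (g ` B)"
    by (rule bounded_linear_image) (rule \<open>bounded B\<close>, rule blinfun.bounded_linear_right)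
  \<comment> \<open>A bounded set of reals has compact closure, and \<open>?f\<close> is
    continuous.\<close>
  then have K: "compact (?f ` closure (g ` B))"
    by (intro compact_continuous_image continuous_intros) (simp add: compact_closure)
  have "blinfun_apply ?T ` B \<subseteq> ?f ` closure (g ` B)"
    using closure_subset by fastforce
  then have "closure (blinfun_apply ?T ` B) \<subseteq> ?f ` closure (g ` B)"
    using K by (intro closure_minimal compact_imp_closed)
  then show "compact (closure (blinfun_apply ?T ` B))"
    using compact_Int_closed[OF K closed_closure] by (metis inf.absorb2)
qed

lemma rank_one_apply: "blinfun_of_compact_op (rank_one g z) x = g x *\<^sub>R z"
  by transfer simp

lemma norm_rank_one_le: "norm (rank_one g z) \<le> norm g * norm z"
  unfolding norm_compact_op.rep_eq rank_one.rep_eq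
  using mult_right_mono[OF norm_blinfun[of g], of "norm z"]
  by (intro norm_blinfun_bound) (auto simp: mult_ac)

lemma bounded_linear_rank_one: "bounded_linear (\<lambda>g. rank_one g z)"
proof (rule bounded_linear_intro[where K = "norm z"])
  show "rank_one (g + h) z = rank_one g z + rank_one h z" for g h
    by transfer (auto intro!: blinfun_eqI simp: blinfun.bilinear_simps scaleR_add_left)
  show "rank_one (c *\<^sub>R g) z = c *\<^sub>R rank_one g z" for c g
    by transfer (auto intro!: blinfun_eqI simp: blinfun.bilinear_simps)
  show "norm (rank_one g z) \<le> norm g * norm z" for g
    by (rule norm_rank_one_le)
qed

section \<open>Reflexivity and weak limits\<close>

lemma reflexive_spaceD:
  fixes \<phi> :: "('a::real_normed_vector \<Rightarrow>\<^sub>L real) \<Rightarrow> real"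
  assumes "reflexive_space TYPE('a)" "bounded_linear \<phi>"
  obtains x where "\<And>g. blinfun_apply g x = \<phi> g"
proof -
  obtain x :: 'a where "bidual_embedding x = Blinfun \<phi>"
    using assms(1) unfolding reflexive_space_def by (metis surjD)
  then have "blinfun_apply g x = \<phi> g" for g
    using bounded_linear_Blinfun_apply[OF assms(2)] bidual_embedding.rep_eq[of x] by metis
  then show thesis by (rule that)
qed

lemma blinfun_apply_separates:
  fixes x y :: "'a::real_normed_vector"
  assumes "\<And>g :: 'a \<Rightarrow>\<^sub>L real. g x = g y"
  shows "x = y"
proof -
  obtain g :: "'a \<Rightarrow>\<^sub>L real" where "g (x - y) = norm (x - y)"
    using norming_functional by blast
  then show ?thesis using assms[of g] by (simp add: blinfun.diff_right)
qed

text \<open>Weak convergence is tested on a norming functional of the limit.\<close>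

lemma weakly_tendsto_norm_le:
  fixes u :: "nat \<Rightarrow> 'a::real_normed_vector"
  assumes "weakly_tendsto u x" "\<And>n. norm (u n) \<le> c"
  shows "norm x \<le> c"
proof -
  obtain g :: "'a \<Rightarrow>\<^sub>L real" where g: "norm g \<le> 1" "g x = norm x"
    by (rule norming_functional)
  have "(\<lambda>n. g (u n)) \<longlonglongrightarrow> norm x"
    using assms(1) g(2) by (metis weakly_tendsto_def)
  moreover have "g (u n) \<le> c" for n
    using norm_blinfun[of g "u n"] mult_right_mono[OF g(1), of "norm (u n)"] assms(2)[of n] by simp
  ultimately show ?thesis by (intro LIMSEQ_le_const2) auto
qed

section \<open>Limits of maximizing sequences\<close>

text \<open>\<open>F\<close> depends on \<open>T\<close> alone, while \<open>l\<close> and \<psi>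
  depend on the sequence; the last identity therefore lets limits of different sequences be
  compared.\<close>

lemma maximizing_sequence:
  fixes T :: "('a::real_normed_vector, 'b::real_normed_vector) compact_op"
  assumes refl: "reflexive_space TYPE('a)" and kk: "kadets_klee TYPE('a)"
    and "T \<noteq> 0" and F: "blinfun_apply F = tangent norm T"
    and x: "\<And>n. norm (x n) = 1"
    and lim: "(\<lambda>n. norm (blinfun_of_compact_op T (x n))) \<longlonglongrightarrow> norm T"
  obtains r l \<psi> where "strict_mono r" "(x \<circ> r) \<longlonglongrightarrow> l" "norm l = 1"
    "\<psi> \<noteq> (0 :: 'b \<Rightarrow>\<^sub>L real)" "\<And>g z. F (rank_one g z) = \<psi> z * g l"
proof -
  let ?T = "blinfun_of_compact_op T"
  have K: "compact (closure (?T ` sphere 0 1))"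
    using blinfun_of_compact_op[of T] bounded_subset[OF bounded_cball sphere_cball]
    by (auto simp: compact_operator_def)
  have xK: "?T (x n) \<in> closure (?T ` sphere 0 1)" for n
    using closure_subset[of "?T ` sphere 0 1"] x[of n] by auto
  obtain y r where r: "strict_mono r" and y: "((\<lambda>n. ?T (x n)) \<circ> r) \<longlonglongrightarrow> y"
    using xK by (auto intro: seq_compactE[OF compact_imp_seq_compact[OF K], of "\<lambda>n. ?T (x n)"])
  have "norm y = norm T"
    using LIMSEQ_unique[OF tendsto_norm[OF y, unfolded o_def]
        LIMSEQ_subseq_LIMSEQ[OF lim r, unfolded o_def]] .
  obtain \<psi> :: "'b \<Rightarrow>\<^sub>L real" where \<psi>: "norm \<psi> \<le> 1" "\<psi> y = norm y"
    by (rule norming_functional)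
  then have "\<psi> y \<noteq> 0" using \<open>norm y = norm T\<close> \<open>T \<noteq> 0\<close> by simp
  have \<psi>T: "(\<lambda>n. \<psi> (?T ((x \<circ> r) n))) \<longlonglongrightarrow> norm T"
    using blinfun.tendsto[OF tendsto_const y, of \<psi>] \<psi>(2) \<open>norm y = norm T\<close> by (simp add: o_def)
  have conv: "(\<lambda>n. \<psi> (blinfun_of_compact_op S ((x \<circ> r) n))) \<longlonglongrightarrow> F S" for S
  proof (rule tendsto_tangent_norm[OF F, where \<phi> = "\<lambda>n S. \<psi> (blinfun_of_compact_op S ((x \<circ> r) n))"])
    show "linear (\<lambda>S. \<psi> (blinfun_of_compact_op S ((x \<circ> r) n)))" for n
      using linear_compose[OF linear_compact_op_apply
          bounded_linear.linear[OF blinfun.bounded_linear_right[of \<psi>]]]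
      by (simp add: o_def)
    show "\<psi> (blinfun_of_compact_op S ((x \<circ> r) n)) \<le> norm S" for n S
      using norm_blinfun[of \<psi> "blinfun_of_compact_op S ((x \<circ> r) n)"]
        mult_right_mono[OF \<psi>(1), of "norm (blinfun_of_compact_op S ((x \<circ> r) n))"]
        norm_compact_op_apply[of S "(x \<circ> r) n"] x by simp
  qed (rule \<psi>T)
  \<comment> \<open>The limit of \<open>g ((x \<circ> r) n)\<close> is read off from the operators
    \<open>rank_one g y\<close>, where the factor \<open>\<psi> y\<close> can be divided
    out.\<close>
  have "bounded_linear (\<lambda>g. F (rank_one g y) / \<psi> y)"
    by (rule bounded_linear_compose[OF bounded_linear_divide
          bounded_linear_compose[OF blinfun.bounded_linear_right bounded_linear_rank_one]])
  then obtain l where l: "\<And>g. blinfun_apply g l = F (rank_one g y) / \<psi> y"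
    using reflexive_spaceD[OF refl] by blast
  have glim: "(\<lambda>n. g ((x \<circ> r) n)) \<longlonglongrightarrow> g l" for g :: "'a \<Rightarrow>\<^sub>L real"
    using tendsto_divide[OF conv[of "rank_one g y"] tendsto_const \<open>\<psi> y \<noteq> 0\<close>] \<open>\<psi> y \<noteq> 0\<close>
    by (simp add: l rank_one_apply blinfun.scaleR_right)
  then have weak: "weakly_tendsto (x \<circ> r) l" by (simp add: weakly_tendsto_def)
  have "norm T \<le> norm T * norm l"
  proof -
    \<comment> \<open>The composition \<open>\<psi> o\<^sub>L ?T\<close> is itself a functional on
      the domain, so weak convergence applies to it.\<close>
    have "\<psi> (?T l) = norm T"
      using LIMSEQ_unique[OF glim[of "\<psi> o\<^sub>L ?T"]] \<psi>T by simp
    then show ?thesis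
      using norm_blinfun[of \<psi> "?T l"] mult_right_mono[OF \<psi>(1), of "norm (?T l)"]
        norm_compact_op_apply[of T l] by simp
  qed
  then have "norm l \<ge> 1" using \<open>T \<noteq> 0\<close> by simp
  moreover have "norm l \<le> 1" using weakly_tendsto_norm_le[OF weak] x by simp
  ultimately have "norm l = 1" by simp
  have "(x \<circ> r) \<longlonglongrightarrow> l"
    using kk weak x \<open>norm l = 1\<close> by (simp add: kadets_klee_def)
  moreover have "F (rank_one g z) = \<psi> z * g l" for g z
  proof (rule LIMSEQ_unique[OF conv])
    show "(\<lambda>n. \<psi> (blinfun_of_compact_op (rank_one g z) ((x \<circ> r) n))) \<longlonglongrightarrow> \<psi> z * g l"
      using tendsto_mult[OF tendsto_const[of "\<psi> z"] glim[of g]]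
      by (simp add: rank_one_apply blinfun.scaleR_right mult.commute)
  qed
  moreover have "\<psi> \<noteq> 0" using \<open>\<psi> y \<noteq> 0\<close> by auto
  ultimately show thesis using that r \<open>norm l = 1\<close> by blast
qed

text \<open>Fixing \<open>z\<close> with \<open>\<psi> z \<noteq> 0\<close> shows that all
  functionals agree on \<open>l\<close> and a multiple of \<open>l'\<close>; the unit norms leave
  only the factors 1 and -1.\<close>

lemma rank_one_functional_unique:
  fixes \<psi> \<psi>' :: "'b::real_normed_vector \<Rightarrow>\<^sub>L real" and l l' :: "'a::real_normed_vector"
  assumes "\<psi> \<noteq> 0" "norm l = 1" "norm l' = 1"
    and eq: "\<And>(g :: 'a \<Rightarrow>\<^sub>L real) z. \<psi> z * g l = \<psi>' z * g l'"
  shows "l = l' \<or> l = - l'"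
proof -
  obtain z where z: "\<psi> z \<noteq> 0" using \<open>\<psi> \<noteq> 0\<close> by (metis blinfun_eqI zero_blinfun.rep_eq)
  define c where "c = \<psi>' z / \<psi> z"
  have "l = c *\<^sub>R l'"
  proof (rule blinfun_apply_separates)
    fix g :: "'a \<Rightarrow>\<^sub>L real"
    show "g l = g (c *\<^sub>R l')"
      using eq[of z g] z by (simp add: c_def blinfun.scaleR_right field_simps)
  qed
  moreover from this have "\<bar>c\<bar> = 1" using assms(2,3) by simp
  ultimately show ?thesis by (auto simp: abs_if split: if_splits)
qed

text \<open>Otherwise homogeneity would make \<open>norm T - \<delta>\<close> a bound for the
  operator norm.\<close>

lemma near_max_set_nonempty:
  fixes T :: "'a::real_normed_vector \<Rightarrow>\<^sub>L 'b::real_normed_vector"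
  assumes "T \<noteq> 0" "0 < \<delta>"
  shows "near_max_set T \<delta> \<noteq> {}"
proof
  assume empty: "near_max_set T \<delta> = {}"
  have sphere: "norm (T x) \<le> norm T - \<delta>" if "norm x = 1" for x
    using that empty by (auto simp: near_max_set_def not_less)
  obtain y where "T y \<noteq> 0" using \<open>T \<noteq> 0\<close> by (metis blinfun_eqI zero_blinfun.rep_eq)
  then have "y \<noteq> 0" by (metis blinfun.zero_right)
  \<comment> \<open>\<open>norm_blinfun_bound\<close> requires a nonnegative constant; the unit
    vector \<open>sgn y\<close> supplies this.\<close>
  then have "0 \<le> norm T - \<delta>"
    using order_trans[OF norm_ge_zero sphere[of "sgn y"]] by (simp add: norm_sgn)
  moreover have "norm (T x) \<le> (norm T - \<delta>) * norm x" for x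
  proof (cases "x = 0")
    case False
    then show ?thesis
      using sphere[of "sgn x"]
      by (simp add: norm_sgn sgn_div_norm blinfun.scaleR_right field_simps)
  qed simp
  ultimately have "norm T \<le> norm T - \<delta>" by (rule norm_blinfun_bound)
  then show False using \<open>0 < \<delta>\<close> by simp
qed

lemma near_max_sequence_tendsto:
  assumes "\<And>n. x n \<in> near_max_set T (1 / real (Suc n))"
  shows "(\<lambda>n. norm (blinfun_apply T (x n))) \<longlonglongrightarrow> norm T"
proof (rule tendsto_sandwich)
  show "(\<lambda>n. norm T - 1 / real (Suc n)) \<longlonglongrightarrow> norm T"
    using tendsto_diff[OF tendsto_const LIMSEQ_inverse_real_of_nat, of "norm T"]
    by (simp add: inverse_eq_divide)
  show "\<forall>\<^sub>F n in sequentially. norm T - 1 / real (Suc n) \<le> norm (T (x n))"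
    using assms by (intro always_eventually) (auto simp: near_max_set_def less_imp_le)
  show "\<forall>\<^sub>F n in sequentially. norm (T (x n)) \<le> norm T"
  proof (intro always_eventually allI)
    fix n show "norm (T (x n)) \<le> norm T"
      using norm_blinfun[of T "x n"] assms[of n] by (simp add: near_max_set_def)
  qed
qed simp

theorem corollary3p2:
  fixes T :: "('a::banach, 'b::banach) compact_op"
  assumes "reflexive_space TYPE('a)"
    and "kadets_klee TYPE('a)"
    and "smooth_element T"
  shows "\<exists>x0 \<in> sphere (0 :: 'a) 1. \<forall>\<epsilon>>0. \<exists>\<delta>\<^sub>\<epsilon>>0. \<forall>\<delta>. 0 < \<delta> \<and> \<delta> \<le> \<delta>\<^sub>\<epsilon> \<longrightarrow>
    near_max_set (blinfun_of_compact_op T) \<delta> \<subseteq> ball x0 \<epsilon> \<union> ball (- x0) \<epsilon>"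
proof -
  let ?T = "blinfun_of_compact_op T"
  have "T \<noteq> 0" using assms(3) by (simp add: smooth_element_def)
  then have "?T \<noteq> 0" by transfer
  obtain F where F: "blinfun_apply F = tangent norm T"
    using smooth_element_tangent[OF assms(3)] .
  have max: "\<exists>r l \<psi>. strict_mono r \<and> (x \<circ> r) \<longlonglongrightarrow> l \<and> norm l = 1 \<and>
      \<psi> \<noteq> (0 :: 'b \<Rightarrow>\<^sub>L real) \<and> (\<forall>g z. F (rank_one g z) = \<psi> z * g l)"
    if "\<And>n. x n \<in> near_max_set ?T (1 / real (Suc n))" for x
  proof (rule maximizing_sequence[OF assms(1,2) \<open>T \<noteq> 0\<close> F])
    show "norm (x n) = 1" for n using that[of n] by (simp add: near_max_set_def)
    show "(\<lambda>n. norm (?T (x n))) \<longlonglongrightarrow> norm T"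
      using near_max_sequence_tendsto[of x ?T] that by (simp add: norm_compact_op.rep_eq)
  qed blast
  have "\<forall>n. \<exists>x. x \<in> near_max_set ?T (1 / real (Suc n))"
    using near_max_set_nonempty[OF \<open>?T \<noteq> 0\<close>] by (simp add: ex_in_conv)
  \<comment> \<open>Any single maximizing sequence provides the center, chosen before
    \<epsilon>.\<close>
  then obtain x0 \<psi> where x0: "norm x0 = 1" "\<psi> \<noteq> (0 :: 'b \<Rightarrow>\<^sub>L real)"
      "\<And>g z. F (rank_one g z) = \<psi> z * g x0"
    using max by metis
  have "\<exists>\<eta>>0. near_max_set ?T \<eta> \<subseteq> ball x0 \<epsilon> \<union> ball (- x0) \<epsilon>" if "\<epsilon> > 0" for \<epsilon>
  proof (rule ccontr)
    assume contr: "\<not> ?thesis"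
    \<comment> \<open>A failure for every \<eta> gives a maximizing sequence that avoids both balls,
      yet a subsequence must converge to \<open>x0\<close> or \<open>- x0\<close>.\<close>
    have "\<forall>n. \<exists>x. x \<in> near_max_set ?T (1 / real (Suc n)) - (ball x0 \<epsilon> \<union> ball (- x0) \<epsilon>)"
    proof
      fix n
      have "1 / real (Suc n) > 0" by simp
      then show "\<exists>x. x \<in> near_max_set ?T (1 / real (Suc n)) - (ball x0 \<epsilon> \<union> ball (- x0) \<epsilon>)"
        using contr by blast
    qed
    then obtain x where x: "\<And>n. x n \<in> near_max_set ?T (1 / real (Suc n)) -
        (ball x0 \<epsilon> \<union> ball (- x0) \<epsilon>)"
      by metis
    obtain r l and \<phi> :: "'b \<Rightarrow>\<^sub>L real" where r: "(x \<circ> r) \<longlonglongrightarrow> l" "norm l = 1"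
        "\<And>g z. F (rank_one g z) = \<phi> z * g l"
      using max[of x] x by blast
    have "x0 = l \<or> x0 = - l"
      using x0 r by (intro rank_one_functional_unique[of \<psi> _ _ \<phi>]) auto
    then have "l \<in> ball x0 \<epsilon> \<union> ball (- x0) \<epsilon>"
      using \<open>\<epsilon> > 0\<close> by auto
    then have "\<forall>\<^sub>F n in sequentially. (x \<circ> r) n \<in> ball x0 \<epsilon> \<union> ball (- x0) \<epsilon>"
      by (intro topological_tendstoD[OF r(1)]) auto
    moreover have "\<forall>n. (x \<circ> r) n \<notin> ball x0 \<epsilon> \<union> ball (- x0) \<epsilon>"
      using x by simp
    ultimately show False by simp
  qed
  \<comment> \<open>Monotonicity extends the inclusion from one \<eta> to all smaller
    \<delta>.\<close>
  moreover have "near_max_set ?T \<delta> \<subseteq> near_max_set ?T \<eta>" if "\<delta> \<le> \<eta>" for \<delta> \<eta>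
    using that by (auto simp: near_max_set_def)
  ultimately show ?thesis
    using x0(1) by (intro bexI[of _ x0] allI impI) (meson subset_trans, simp)
qed

end
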